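(* Let $D$ be a nontrivial bounded distributive lattice. Then the lattice $\mathrm{K}(D)$ is locally finite. In fact, $\mathrm{K}(D)$ generates a locally finite lattice variety.
   Context: $\mathbf{2}=\{0,1\}$ is the two-element lattice. For a nontrivial bounded distributive lattice $D$ (so $0\neq1$ in $D$) and $x\in D$, put $x^-:=1$ if $x=1$ and $x^-:=0$ if $x<1$ (likewise for $x\in\mathbf{2}$; the bounds of $\mathbf 2$ are identified with those of $D$). Put $\mathrm{L}(D):=\mathbf{2}\times D\times\mathbf{2}\times\mathbf{2}$, and let $\mathrm{K}(D)$ be the set of all $(x_0,x_1,x_2,x_3)\in\mathrm{L}(D)$ such that $x_i^-\wedge x_k^-\le x_j$ for all $i<j<k$ in $\{0,1,2,3\}$, ordered componentwise. Then $\mathrm{K}(D)$ is closed under componentwise meets and every element of $\mathrm{L}(D)$ has a least element of $\mathrm{K}(D)$ above it, so $\mathrm{K}(D)$ is a bounded lattice (meets are componentwise; the join of $x,y$ is the least element of $\mathrm{K}(D)$ above the componentwise join). A lattice is locally finite if each of its finitely generated sublattices is finite; a variety is locally finite if all its members are locally finite. *)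

theory Defs
  imports "HOL-Algebra.Lattice"
begin

locale nontrivial_bounded_distributive_lattice = bounded_lattice +
  assumes meet_join_distrib:
    "\<lbrakk>x \<in> carrier L; y \<in> carrier L; z \<in> carrier L\<rbrakk> \<Longrightarrow>
      x \<sqinter> (y \<squnion> z) = (x \<sqinter> y) \<squnion> (x \<sqinter> z)"
    and nontrivial: "\<bottom> \<noteq> \<top>"

definition minus_part :: "('a, 'b) gorder_scheme \<Rightarrow> 'a \<Rightarrow> 'a" where
  "minus_part D x = (if x = \<top>\<^bsub>D\<^esub> then \<top>\<^bsub>D\<^esub> else \<bottom>\<^bsub>D\<^esub>)"

text \<open>
  The two-element lattice is realised inside \<open>D\<close> as \<open>{\<bottom>, \<top>}\<close>, which is how its bounds are
  identified with those of \<open>D\<close>. Quadruples are extensional functions on \<open>{..3}\<close>, so that two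
  elements of \<open>L_carrier D\<close> are equal iff their four coordinates agree.
\<close>
definition L_carrier :: "('a, 'b) gorder_scheme \<Rightarrow> (nat \<Rightarrow> 'a) set" where
  "L_carrier D =
    (\<Pi>\<^sub>E i\<in>{..3}. if i = 1 then carrier D else {\<bottom>\<^bsub>D\<^esub>, \<top>\<^bsub>D\<^esub>})"

definition K_lattice :: "('a, 'b) gorder_scheme \<Rightarrow> (nat \<Rightarrow> 'a) gorder" where
  "K_lattice D =
    \<lparr>carrier = {x \<in> L_carrier D. \<forall>i j k. i < j \<and> j < k \<and> k \<le> 3 \<longrightarrow>
        minus_part D (x i) \<sqinter>\<^bsub>D\<^esub> minus_part D (x k) \<sqsubseteq>\<^bsub>D\<^esub> x j},
     eq = (=),
     le = (\<lambda>x y. \<forall>i\<le>3. x i \<sqsubseteq>\<^bsub>D\<^esub> y i)\<rparr>"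

definition sublattice :: "'a set \<Rightarrow> ('a, 'b) gorder_scheme \<Rightarrow> bool" where
  "sublattice S L \<longleftrightarrow> S \<subseteq> carrier L \<and>
    (\<forall>x\<in>S. \<forall>y\<in>S. x \<sqinter>\<^bsub>L\<^esub> y \<in> S \<and> x \<squnion>\<^bsub>L\<^esub> y \<in> S)"

definition generated_sublattice :: "('a, 'b) gorder_scheme \<Rightarrow> 'a set \<Rightarrow> 'a set" where
  "generated_sublattice L A = \<Inter>{S. sublattice S L \<and> A \<subseteq> S}"

definition locally_finite_lattice :: "('a, 'b) gorder_scheme \<Rightarrow> bool" where
  "locally_finite_lattice L \<longleftrightarrow> lattice L \<and>
    (\<forall>A. A \<subseteq> carrier L \<and> finite A \<longrightarrow> finite (generated_sublattice L A))"

datatype lattice_term =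
    Var nat
  | Meet lattice_term lattice_term
  | Join lattice_term lattice_term

primrec eval_term :: "('a, 'b) gorder_scheme \<Rightarrow> (nat \<Rightarrow> 'a) \<Rightarrow> lattice_term \<Rightarrow> 'a" where
  "eval_term L v (Var n) = v n"
| "eval_term L v (Meet s t) = eval_term L v s \<sqinter>\<^bsub>L\<^esub> eval_term L v t"
| "eval_term L v (Join s t) = eval_term L v s \<squnion>\<^bsub>L\<^esub> eval_term L v t"

definition satisfies_identity ::
    "('a, 'b) gorder_scheme \<Rightarrow> lattice_term \<times> lattice_term \<Rightarrow> bool" where
  "satisfies_identity L e \<longleftrightarrow>
    (\<forall>v. range v \<subseteq> carrier L \<longrightarrow> eval_term L v (fst e) = eval_term L v (snd e))"

definition lattice_variety :: "(lattice_term \<times> lattice_term) set \<Rightarrow> 'a gorder set" where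
  "lattice_variety \<Sigma> = {L. lattice L \<and> (\<forall>e\<in>\<Sigma>. satisfies_identity L e)}"

text \<open>
  The smallest lattice variety containing \<open>K\<close>. A variety has members over arbitrary types, so it is
  given by its defining identities \<open>\<Sigma>\<close>, and \<open>generated_variety K\<close> has its members of type
  \<open>'b gorder\<close>, where \<open>'b\<close> is unrelated to the type of \<open>K\<close>.
\<close>
definition generated_variety :: "'a gorder \<Rightarrow> 'b gorder set" where
  "generated_variety K = \<Inter>{lattice_variety \<Sigma> |\<Sigma>. K \<in> lattice_variety \<Sigma>}"

end

theory Submission
  imports Defs
begin

text \<open>
  The closure of a quadruple in \<open>K(D)\<close> only ever replaces coordinates by \<open>\<top>\<close>, and whether it does so
  depends on which coordinates are \<open>\<top>\<close>. Hence the value of an \<open>n\<close>-ary term at a valuation \<open>v\<close> has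
  as its coordinate in \<open>D\<close> the value of one of the finitely many \<open>n\<close>-ary bounded lattice polynomials
  of \<open>D\<close>, and which one, as well as the other three coordinates, depends only on a finite amount of
  information about \<open>v\<close>: the coordinates of the arguments and the polynomials that evaluate to \<open>\<top>\<close>.
  So \<open>K(D)\<close> has finitely many \<open>n\<close>-ary term functions, which bounds the \<open>n\<close>-generated members of
  its variety.
\<close>

section \<open>Term functions and local finiteness\<close>

primrec vars :: "lattice_term \<Rightarrow> nat set" where
  "vars (Var n) = {n}"
| "vars (Meet s t) = vars s \<union> vars t"
| "vars (Join s t) = vars s \<union> vars t"

text \<open>Restricting to valuations into the carrier turns agreement of two terms on all such
  valuations into equality of functions. Counting term functions is then counting terms modulo the
  identities of \<open>L\<close>.\<close>

definition term_function ::
    "('a, 'b) gorder_scheme \<Rightarrow> lattice_term \<Rightarrow> (nat \<Rightarrow> 'a) \<Rightarrow> 'a" where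
  "term_function L t = (\<lambda>v\<in>{v. range v \<subseteq> carrier L}. eval_term L v t)"

lemma satisfies_identity_iff_term_function:
  "satisfies_identity L (s, t) \<longleftrightarrow> term_function L s = term_function L t"
proof
  assume "term_function L s = term_function L t"
  then have "term_function L s v = term_function L t v" for v
    by simp
  then show "satisfies_identity L (s, t)"
    unfolding satisfies_identity_def term_function_def
    by (metis (mono_tags, lifting) fst_conv mem_Collect_eq restrict_apply' snd_conv)
qed (auto simp: satisfies_identity_def term_function_def fun_eq_iff)

lemma (in lattice) eval_term_closed:
  "range v \<subseteq> carrier L \<Longrightarrow> eval_term L v t \<in> carrier L"
  by (induction t) auto

text \<open>On \<open>T\<close> the map \<open>g\<close> factors through \<open>f\<close>, so its
  image is no larger than that of \<open>f\<close>; \<open>inv_into\<close> picks a preimage of each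
  value of \<open>f\<close>.\<close>

lemma finite_image_factor:
  assumes "finite (f ` T)" and "\<And>s t. s \<in> T \<Longrightarrow> t \<in> T \<Longrightarrow> f s = f t \<Longrightarrow> g s = g t"
  shows "finite (g ` T)"
proof -
  have "g ` T \<subseteq> (\<lambda>y. g (inv_into T f y)) ` f ` T"
  proof
    fix y assume "y \<in> g ` T"
    then obtain t where t: "t \<in> T" "y = g t" by auto
    then have "g (inv_into T f (f t)) = g t"
      by (intro assms(2)) (auto intro: inv_into_into f_inv_into_f)
    with t show "y \<in> (\<lambda>y. g (inv_into T f y)) ` f ` T" by force
  qed
  with assms(1) show ?thesis by (meson finite_imageI finite_subset)
qed

text \<open>Elements of a sublattice with \<open>n\<close> generators are values of terms in
  \<open>n\<close> variables at one valuation \<open>w\<close> that lists the generators. Such a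
  value depends only on the term function over \<open>K\<close>, because identities of
  \<open>K\<close> hold in \<open>L\<close>.\<close>

lemma (in lattice) locally_finite_if_finite_term_functions:
  assumes fin: "\<And>n. finite (term_function K ` {t. vars t \<subseteq> {..<n}})"
    and ids: "\<And>e. satisfies_identity K e \<Longrightarrow> satisfies_identity L e"
  shows "locally_finite_lattice L"
proof -
  have "finite (generated_sublattice L A)" if A: "A \<subseteq> carrier L" "finite A" for A
  proof (cases "A = {}")
    case True
    \<comment> \<open>The empty set counts as a sublattice, so nothing generates nothing.\<close>
    then have "generated_sublattice L A \<subseteq> {}"
      unfolding generated_sublattice_def sublattice_def by blast
    then show ?thesis by simp
  next
    case False
    obtain n and f :: "nat \<Rightarrow> 'a" where f: "A = f ` {..<n}"
      using \<open>finite A\<close> by (metis finite_imp_nat_seg_image_inj_on lessThan_def)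
    \<comment> \<open>Identities are tested on total valuations into the carrier, so the variables
      from \<open>n\<close> on also need values; any element of the nonempty \<open>A\<close>
      serves.\<close>
    define w where "w i = (if i < n then f i else (SOME a. a \<in> A))" for i
    have "w i \<in> A" for i
      using False f by (auto simp: w_def some_in_eq)
    with A have w: "range w \<subseteq> carrier L" by auto
    let ?T = "{t. vars t \<subseteq> {..<n}}" and ?S = "(\<lambda>t. eval_term L w t) ` {t. vars t \<subseteq> {..<n}}"
    have "finite ?S"
    proof (rule finite_image_factor[OF fin])
      fix s t assume "term_function K s = term_function K t"
      then have "satisfies_identity L (s, t)"
        by (intro ids) (simp add: satisfies_identity_iff_term_function)
      with w show "eval_term L w s = eval_term L w t"
        by (auto simp: satisfies_identity_def)
    qed
    moreover have "generated_sublattice L A \<subseteq> ?S"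
    proof -
      have "eval_term L w s \<sqinter> eval_term L w t \<in> ?S" "eval_term L w s \<squnion> eval_term L w t \<in> ?S"
        if "s \<in> ?T" "t \<in> ?T" for s t
        using that imageI[of "Meet s t" ?T "eval_term L w"] imageI[of "Join s t" ?T "eval_term L w"]
        by simp_all
      then have "sublattice ?S L"
        using eval_term_closed[OF w] by (auto simp: sublattice_def)
      moreover have "A \<subseteq> ?S"
      proof
        fix a assume "a \<in> A"
        then obtain i where "i < n" "a = f i" using f by auto
        then show "a \<in> ?S"
          by (intro image_eqI[of _ _ "Var i"]) (auto simp: w_def)
      qed
      ultimately show ?thesis by (auto simp: generated_sublattice_def)
    qed
    ultimately show ?thesis by (rule rev_finite_subset)
  qed
  then show ?thesis
    by (auto simp: locally_finite_lattice_def lattice_axioms)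
qed

text \<open>The join is selected by a choice operator; uniqueness of least upper bounds identifies
  it with a known one.\<close>

lemma (in partial_order) is_lub_join:
  assumes "is_lub L z {x, y}"
  shows "x \<squnion> y = z"
  unfolding join_def Lattice.sup_def using assms least_unique by blast

lemma (in partial_order) is_glb_meet:
  assumes "is_glb L z {x, y}"
  shows "x \<sqinter> y = z"
  unfolding meet_def Lattice.inf_def using assms greatest_unique by blast

section \<open>Polynomials of bounded distributive lattices\<close>

text \<open>Every polynomial in \<open>d 0, \<dots>, d n\<close> has the form \<open>s \<squnion> (t \<sqinter> d n)\<close> with \<open>s\<close>, \<open>t\<close> not involving \<open>d n\<close>.\<close>
primrec polynomials :: "('a, 'b) gorder_scheme \<Rightarrow> nat \<Rightarrow> ((nat \<Rightarrow> 'a) \<Rightarrow> 'a) set" where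
  "polynomials D 0 =
    {\<lambda>d\<in>{d. range d \<subseteq> carrier D}. \<bottom>\<^bsub>D\<^esub>, \<lambda>d\<in>{d. range d \<subseteq> carrier D}. \<top>\<^bsub>D\<^esub>}"
| "polynomials D (Suc n) =
    (\<lambda>(s, t). \<lambda>d\<in>{d. range d \<subseteq> carrier D}. s d \<squnion>\<^bsub>D\<^esub> (t d \<sqinter>\<^bsub>D\<^esub> d n))
      ` (polynomials D n \<times> polynomials D n)"

lemma finite_polynomials: "finite (polynomials D n)"
  by (induction n) auto

context nontrivial_bounded_distributive_lattice
begin

abbreviation points :: "(nat \<Rightarrow> 'a) set" where
  "points \<equiv> {d. range d \<subseteq> carrier L}"

section \<open>Lattice laws as equations\<close>

lemma join_assoc:
  "\<lbrakk>x \<in> carrier L; y \<in> carrier L; z \<in> carrier L\<rbrakk> \<Longrightarrow> x \<squnion> y \<squnion> z = x \<squnion> (y \<squnion> z)"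
  using weak_join_assoc by (simp add: eq_is_equal)

lemma meet_assoc:
  "\<lbrakk>x \<in> carrier L; y \<in> carrier L; z \<in> carrier L\<rbrakk> \<Longrightarrow> x \<sqinter> y \<sqinter> z = x \<sqinter> (y \<sqinter> z)"
  using weak_meet_assoc by (simp add: eq_is_equal)

lemma join_left_comm:
  "\<lbrakk>x \<in> carrier L; y \<in> carrier L; z \<in> carrier L\<rbrakk> \<Longrightarrow> y \<squnion> (x \<squnion> z) = x \<squnion> (y \<squnion> z)"
  by (metis join_assoc join_comm)

lemma meet_idem: "x \<in> carrier L \<Longrightarrow> x \<sqinter> x = x"
  by (metis le_iff_join le_refl)

lemma join_meet_distrib:
  "\<lbrakk>x \<in> carrier L; y \<in> carrier L; z \<in> carrier L\<rbrakk> \<Longrightarrow> (y \<squnion> z) \<sqinter> x = (y \<sqinter> x) \<squnion> (z \<sqinter> x)"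
  by (metis meet_comm meet_join_distrib)

lemma bottom_simps [simp]:
  assumes "x \<in> carrier L"
  shows "\<bottom> \<sqinter> x = \<bottom>" "x \<sqinter> \<bottom> = \<bottom>" "\<bottom> \<squnion> x = x" "x \<squnion> \<bottom> = x"
  using bottom_meet[OF assms] bottom_join[OF assms] assms
  by (auto simp: eq_is_equal join_comm[of _ x] meet_comm[of _ x])

lemma top_simps [simp]:
  assumes "x \<in> carrier L"
  shows "\<top> \<sqinter> x = x" "x \<sqinter> \<top> = x" "\<top> \<squnion> x = \<top>" "x \<squnion> \<top> = \<top>"
  using top_meet[OF assms] top_join[OF assms] assms
  by (auto simp: eq_is_equal join_comm[of _ x] meet_comm[of _ x])

text \<open>By distributivity the coefficients of \<open>a\<close> can be collected. This is the
  induction step for closure of polynomials under joins.\<close>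

lemma normal_form_join:
  assumes "s \<in> carrier L" "t \<in> carrier L" "s' \<in> carrier L" "t' \<in> carrier L" "a \<in> carrier L"
  shows "(s \<squnion> (t \<sqinter> a)) \<squnion> (s' \<squnion> (t' \<sqinter> a)) = (s \<squnion> s') \<squnion> ((t \<squnion> t') \<sqinter> a)"
  using assms by (simp add: join_meet_distrib join_assoc join_left_comm)

text \<open>Multiplying out gives four products; the three that contain \<open>a\<close> are
  collected into one coefficient, using idempotence for the product of \<open>t \<sqinter> a\<close>
  and \<open>t' \<sqinter> a\<close>.\<close>

lemma normal_form_meet:
  assumes "s \<in> carrier L" "t \<in> carrier L" "s' \<in> carrier L" "t' \<in> carrier L" "a \<in> carrier L"
  shows "(s \<squnion> (t \<sqinter> a)) \<sqinter> (s' \<squnion> (t' \<sqinter> a)) =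
    (s \<sqinter> s') \<squnion> (((s \<sqinter> t') \<squnion> ((t \<sqinter> s') \<squnion> (t \<sqinter> t'))) \<sqinter> a)"
proof -
  have "(t \<sqinter> a) \<sqinter> (t' \<sqinter> a) = (t \<sqinter> t') \<sqinter> a"
    using assms by (metis meet_assoc meet_comm meet_idem meet_closed)
  moreover have "(t \<sqinter> a) \<sqinter> s' = (t \<sqinter> s') \<sqinter> a"
    using assms by (metis meet_assoc meet_comm)
  ultimately show ?thesis
    using assms by (simp add: join_meet_distrib meet_join_distrib join_assoc join_left_comm meet_assoc)
qed

section \<open>Closure properties of the polynomials\<close>

lemma polynomials_closed:
  "s \<in> polynomials L n \<Longrightarrow> d \<in> points \<Longrightarrow> s d \<in> carrier L"
  by (induction n arbitrary: s) (auto simp: image_subset_iff)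

text \<open>Polynomials are extensional functions, so agreement with a normal form on
  \<open>points\<close> suffices once \<open>u\<close> is restricted to them.\<close>

lemma polynomials_SucI:
  assumes "s \<in> polynomials L n" "t \<in> polynomials L n"
    and "\<And>d. d \<in> points \<Longrightarrow> u d = s d \<squnion> (t d \<sqinter> d n)"
  shows "restrict u points \<in> polynomials L (Suc n)"
proof -
  have "restrict u points = (\<lambda>d\<in>points. s d \<squnion> (t d \<sqinter> d n))"
    by (rule restrict_ext) (rule assms(3))
  then show ?thesis
    using assms(1,2) by (auto simp del: restrict_apply intro!: image_eqI[of _ _ "(s, t)"])
qed

lemma polynomials_SucE:
  assumes "u \<in> polynomials L (Suc n)"
  obtains s t where "s \<in> polynomials L n" "t \<in> polynomials L n"
    and "\<And>d. d \<in> points \<Longrightarrow> u d = s d \<squnion> (t d \<sqinter> d n)"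
  using assms by auto

lemma polynomials_restrict:
  "s \<in> polynomials L n \<Longrightarrow> restrict s points = s"
  by (cases n) auto

text \<open>Both constants persist at every level with coefficient \<bottom> of the new
  variable.\<close>

lemma const_in_polynomials:
  "(\<lambda>d\<in>points. \<bottom>) \<in> polynomials L n" "(\<lambda>d\<in>points. \<top>) \<in> polynomials L n"
proof (induction n)
  case (Suc n)
  show "(\<lambda>d\<in>points. \<bottom>) \<in> polynomials L (Suc n)"
    by (rule polynomials_SucI[OF Suc.IH(1) Suc.IH(1)]) (auto simp: image_subset_iff)
  show "(\<lambda>d\<in>points. \<top>) \<in> polynomials L (Suc n)"
    by (rule polynomials_SucI[OF Suc.IH(2) Suc.IH(1)]) (auto simp: image_subset_iff)
qed simp_all

lemma polynomials_Suc_subset: "polynomials L n \<subseteq> polynomials L (Suc n)"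
proof
  fix s assume s: "s \<in> polynomials L n"
  have "restrict s points \<in> polynomials L (Suc n)"
    by (rule polynomials_SucI[OF s const_in_polynomials(1)])
      (auto simp: image_subset_iff polynomials_closed[OF s])
  with polynomials_restrict[OF s] show "s \<in> polynomials L (Suc n)" by simp
qed

lemma projection_in_polynomials: "i < n \<Longrightarrow> (\<lambda>d\<in>points. d i) \<in> polynomials L n"
proof (induction n)
  case (Suc n)
  show ?case
  proof (cases "i = n")
    case True
    \<comment> \<open>The newest variable has the normal form
      \<open>\<bottom> \<squnion> (\<top> \<sqinter> d n)\<close>.\<close>
    show ?thesis
      by (rule polynomials_SucI[OF const_in_polynomials]) (auto simp: True image_subset_iff)
  next
    case False
    with Suc have "(\<lambda>d\<in>points. d i) \<in> polynomials L n" by linarith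
    then show ?thesis using polynomials_Suc_subset by blast
  qed
qed simp

lemma join_in_polynomials:
  "\<lbrakk>s \<in> polynomials L n; t \<in> polynomials L n\<rbrakk> \<Longrightarrow> (\<lambda>d\<in>points. s d \<squnion> t d) \<in> polynomials L n"
proof (induction n arbitrary: s t)
  case 0
  then consider "restrict (\<lambda>d. s d \<squnion> t d) points = restrict (\<lambda>d. \<bottom>) points"
    | "restrict (\<lambda>d. s d \<squnion> t d) points = restrict (\<lambda>d. \<top>) points"
    by (auto cong: restrict_cong)
  then show ?case by cases (simp_all del: restrict_apply)
next
  case (Suc n)
  obtain s1 s2 where s12: "s1 \<in> polynomials L n" "s2 \<in> polynomials L n"
    and s: "\<And>d. d \<in> points \<Longrightarrow> s d = s1 d \<squnion> (s2 d \<sqinter> d n)"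
    using polynomials_SucE[OF Suc.prems(1)] by blast
  obtain t1 t2 where t12: "t1 \<in> polynomials L n" "t2 \<in> polynomials L n"
    and t: "\<And>d. d \<in> points \<Longrightarrow> t d = t1 d \<squnion> (t2 d \<sqinter> d n)"
    using polynomials_SucE[OF Suc.prems(2)] by blast
  show ?case
    by (rule polynomials_SucI[OF Suc.IH[OF s12(1) t12(1)] Suc.IH[OF s12(2) t12(2)]])
      (auto simp: s t image_subset_iff normal_form_join s12[THEN polynomials_closed]
        t12[THEN polynomials_closed])
qed

text \<open>The coefficient of \<open>d n\<close> in a meet of normal forms is a join of three
  meets, so closure under joins is used alongside the induction hypothesis.\<close>

lemma meet_in_polynomials:
  "\<lbrakk>s \<in> polynomials L n; t \<in> polynomials L n\<rbrakk> \<Longrightarrow> (\<lambda>d\<in>points. s d \<sqinter> t d) \<in> polynomials L n"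
proof (induction n arbitrary: s t)
  case 0
  then consider "restrict (\<lambda>d. s d \<sqinter> t d) points = restrict (\<lambda>d. \<bottom>) points"
    | "restrict (\<lambda>d. s d \<sqinter> t d) points = restrict (\<lambda>d. \<top>) points"
    by (auto cong: restrict_cong)
  then show ?case by cases (simp_all del: restrict_apply)
next
  case (Suc n)
  obtain s1 s2 where s12: "s1 \<in> polynomials L n" "s2 \<in> polynomials L n"
    and s: "\<And>d. d \<in> points \<Longrightarrow> s d = s1 d \<squnion> (s2 d \<sqinter> d n)"
    using polynomials_SucE[OF Suc.prems(1)] by blast
  obtain t1 t2 where t12: "t1 \<in> polynomials L n" "t2 \<in> polynomials L n"
    and t: "\<And>d. d \<in> points \<Longrightarrow> t d = t1 d \<squnion> (t2 d \<sqinter> d n)"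
    using polynomials_SucE[OF Suc.prems(2)] by blast
  show ?case
    by (rule polynomials_SucI[OF Suc.IH[OF s12(1) t12(1)]
          join_in_polynomials[OF Suc.IH[OF s12(1) t12(2)]
            join_in_polynomials[OF Suc.IH[OF s12(2) t12(1)] Suc.IH[OF s12(2) t12(2)]]]])
      (auto simp: s t image_subset_iff normal_form_meet s12[THEN polynomials_closed]
        t12[THEN polynomials_closed])
qed

end

section \<open>Meets and joins in K(D)\<close>

text \<open>The coordinates in the two-element lattice are passed as Booleans, which makes
  membership in \<open>K(D)\<close> and its order nearly propositional.\<close>

definition quad :: "('a, 'b) gorder_scheme \<Rightarrow> bool \<Rightarrow> 'a \<Rightarrow> bool \<Rightarrow> bool \<Rightarrow> nat \<Rightarrow> 'a" where
  "quad D a d b c = (\<lambda>i\<in>{..3}. if i = 1 then d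
    else if (if i = 0 then a else if i = 2 then b else c) then \<top>\<^bsub>D\<^esub> else \<bottom>\<^bsub>D\<^esub>)"

lemma quad_apply [simp]:
  "quad D a d b c 0 = (if a then \<top>\<^bsub>D\<^esub> else \<bottom>\<^bsub>D\<^esub>)"
  "quad D a d b c 1 = d"
  "quad D a d b c (Suc 0) = d"
  "quad D a d b c 2 = (if b then \<top>\<^bsub>D\<^esub> else \<bottom>\<^bsub>D\<^esub>)"
  "quad D a d b c 3 = (if c then \<top>\<^bsub>D\<^esub> else \<bottom>\<^bsub>D\<^esub>)"
  by (simp_all add: quad_def)

lemma le_3_cases: "i \<le> 3 \<longleftrightarrow> i = 0 \<or> i = 1 \<or> i = 2 \<or> i = (3::nat)"
  by auto

lemma triples_up_to_3:
  "(\<forall>i j k. i < j \<and> j < k \<and> k \<le> 3 \<longrightarrow> P i j k) \<longleftrightarrow>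
    P 0 1 2 \<and> P 0 1 3 \<and> P 0 2 3 \<and> P 1 2 (3::nat)"
proof
  assume *: "P 0 1 2 \<and> P 0 1 3 \<and> P 0 2 3 \<and> P 1 2 3"
  have "P i j k" if "i < j" "j < k" "k \<le> 3" for i j k
  proof -
    have "(i, j, k) \<in> {(0, 1, 2), (0, 1, 3), (0, 2, 3), (1, 2, 3)}"
      using that by auto
    with * show ?thesis by auto
  qed
  then show "\<forall>i j k. i < j \<and> j < k \<and> k \<le> 3 \<longrightarrow> P i j k" by blast
qed auto

context nontrivial_bounded_distributive_lattice
begin

abbreviation K :: "(nat \<Rightarrow> 'a) gorder" where
  "K \<equiv> K_lattice L"

lemma top_le_iff: "x \<in> carrier L \<Longrightarrow> \<top> \<sqsubseteq> x \<longleftrightarrow> x = \<top>"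
  by (metis le_antisym le_refl top_closed top_higher)

lemma le_bottom_iff: "x \<in> carrier L \<Longrightarrow> x \<sqsubseteq> \<bottom> \<longleftrightarrow> x = \<bottom>"
  by (metis le_antisym le_refl bottom_closed bottom_lower)

lemma meet_eq_top_iff:
  "\<lbrakk>x \<in> carrier L; y \<in> carrier L\<rbrakk> \<Longrightarrow> x \<sqinter> y = \<top> \<longleftrightarrow> x = \<top> \<and> y = \<top>"
  by (metis meet_closed meet_left meet_right top_le_iff top_simps(1))

text \<open>The index triples (0,1,2) and (0,1,3) give the condition that forces \<open>d\<close> up
  to \<top>; (0,2,3) and (1,2,3) give the one that forces \<open>b\<close>.\<close>

lemma quad_in_K_iff:
  "quad L a d b c \<in> carrier K \<longleftrightarrow>
    d \<in> carrier L \<and> (a \<and> (b \<or> c) \<longrightarrow> d = \<top>) \<and> (c \<and> (a \<or> d = \<top>) \<longrightarrow> b)"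
proof -
  have "quad L a d b c \<in> L_carrier L \<longleftrightarrow> d \<in> carrier L"
    unfolding L_carrier_def PiE_iff Ball_def atMost_iff le_3_cases
    by (auto simp: quad_def)
  then show ?thesis
    unfolding K_lattice_def
    using nontrivial nontrivial[symmetric]
    by (auto simp: triples_up_to_3 minus_part_def top_le_iff le_bottom_iff)
qed

lemma quad_le_iff:
  assumes "d \<in> carrier L" "d' \<in> carrier L"
  shows "quad L a d b c \<sqsubseteq>\<^bsub>K\<^esub> quad L a' d' b' c' \<longleftrightarrow>
    (a \<longrightarrow> a') \<and> d \<sqsubseteq> d' \<and> (b \<longrightarrow> b') \<and> (c \<longrightarrow> c')"
  using nontrivial nontrivial[symmetric]
  by (auto simp: K_lattice_def le_3_cases top_le_iff le_bottom_iff assms)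

lemma K_cases:
  assumes "x \<in> carrier K"
  obtains a d b c where "x = quad L a d b c" "quad L a d b c \<in> carrier K"
proof -
  have x: "x \<in> L_carrier L" using assms by (auto simp: K_lattice_def)
  have "x = quad L (x 0 = \<top>) (x 1) (x 2 = \<top>) (x 3 = \<top>)"
  proof (rule PiE_ext[OF x[unfolded L_carrier_def]])
    show "quad L (x 0 = \<top>) (x 1) (x 2 = \<top>) (x 3 = \<top>) \<in>
        (\<Pi>\<^sub>E i\<in>{..3}. if i = 1 then carrier L else {\<bottom>, \<top>})"
      using PiE_mem[OF x[unfolded L_carrier_def], of 1] by (auto simp: quad_def PiE_iff)
  next
    fix i :: nat assume i: "i \<in> {..3}"
    then have "i \<noteq> 1 \<Longrightarrow> x i = \<bottom> \<or> x i = \<top>"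
      using x by (auto simp: L_carrier_def PiE_iff split: if_splits)
    then show "x i = quad L (x 0 = \<top>) (x 1) (x 2 = \<top>) (x 3 = \<top>) i"
      using i by (auto simp: le_3_cases)
  qed
  with assms that show ?thesis by metis
qed

definition quad_meet where
  "quad_meet a d b c a' d' b' c' = quad L (a \<and> a') (d \<sqinter> d') (b \<and> b') (c \<and> c')"

text \<open>
  Closing the componentwise join: coordinate \<open>1\<close> of the closure need not be consulted for
  coordinate \<open>2\<close>, since it is raised only when \<open>a \<or> a'\<close> holds.
\<close>
definition quad_join where
  "quad_join a d b c a' d' b' c' =
    quad L (a \<or> a') (if (a \<or> a') \<and> (b \<or> b' \<or> c \<or> c') then \<top> else d \<squnion> d')
      (b \<or> b' \<or> (c \<or> c') \<and> (a \<or> a' \<or> d \<squnion> d' = \<top>)) (c \<or> c')"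

section \<open>The lattice structure of \<open>K(D)\<close>\<close>

lemma K_antisym:
  assumes "x \<sqsubseteq>\<^bsub>K\<^esub> y" "y \<sqsubseteq>\<^bsub>K\<^esub> x" "x \<in> carrier K" "y \<in> carrier K"
  shows "x = y"
proof -
  obtain a d b c where x: "x = quad L a d b c" "quad L a d b c \<in> carrier K"
    using assms(3) by (rule K_cases)
  obtain a' d' b' c' where y: "y = quad L a' d' b' c'" "quad L a' d' b' c' \<in> carrier K"
    using assms(4) by (rule K_cases)
  have d: "d \<in> carrier L" "d' \<in> carrier L"
    using x y by (auto simp: quad_in_K_iff)
  have "a = a'" "b = b'" "c = c'" "d = d'"
    using assms(1,2) d unfolding x y quad_le_iff[OF d] quad_le_iff[OF d(2,1)]
    by (auto intro: le_antisym)
  with x y show ?thesis by simp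
qed

lemma K_coordinate_closed:
  assumes "x \<in> carrier K" "i \<le> 3"
  shows "x i \<in> carrier L"
proof -
  have "x \<in> L_carrier L" using assms(1) by (simp add: K_lattice_def)
  then have "x i \<in> (if i = 1 then carrier L else {\<bottom>, \<top>})"
    unfolding L_carrier_def by (rule PiE_mem) (simp add: assms(2))
  then show ?thesis by (auto split: if_splits)
qed

lemma range_coordinate_closed:
  assumes "range v \<subseteq> carrier K"
  shows "range (\<lambda>i. v i 1) \<subseteq> carrier L"
  using assms K_coordinate_closed[of _ 1] by (auto simp: image_subset_iff)

lemma partial_order_K: "partial_order K"
proof
  show "x \<sqsubseteq>\<^bsub>K\<^esub> z"
    if "x \<sqsubseteq>\<^bsub>K\<^esub> y" "y \<sqsubseteq>\<^bsub>K\<^esub> z" "x \<in> carrier K" "y \<in> carrier K" "z \<in> carrier K" for x y z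
  proof -
    have "x i \<sqsubseteq> z i" if "i \<le> 3" for i
    proof (rule le_trans[of _ "y i"])
      show "x i \<sqsubseteq> y i" "y i \<sqsubseteq> z i"
        using \<open>x \<sqsubseteq>\<^bsub>K\<^esub> y\<close> \<open>y \<sqsubseteq>\<^bsub>K\<^esub> z\<close> \<open>i \<le> 3\<close> by (auto simp: K_lattice_def)
    qed (use that \<open>x \<in> carrier K\<close> \<open>y \<in> carrier K\<close> \<open>z \<in> carrier K\<close> in
        \<open>auto intro: K_coordinate_closed\<close>)
    then show ?thesis by (simp add: K_lattice_def)
  qed
  show "x \<sqsubseteq>\<^bsub>K\<^esub> x" if "x \<in> carrier K" for x
    using K_coordinate_closed[OF that] by (auto simp: K_lattice_def)
  show "x .=\<^bsub>K\<^esub> y" if "x \<sqsubseteq>\<^bsub>K\<^esub> y" "y \<sqsubseteq>\<^bsub>K\<^esub> x" "x \<in> carrier K" "y \<in> carrier K" for x y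
    using K_antisym[OF that] by (simp add: K_lattice_def)
qed (simp_all add: K_lattice_def)

text \<open>A meet equals \<top> only if both arguments do, so the closure conditions pass from the
  two quadruples to their componentwise meet.\<close>

lemma is_glb_quad_meet:
  assumes "quad L a d b c \<in> carrier K" "quad L a' d' b' c' \<in> carrier K"
  shows "is_glb K (quad_meet a d b c a' d' b' c') {quad L a d b c, quad L a' d' b' c'}"
proof (rule greatest_LowerI)
  have d: "d \<in> carrier L" "d' \<in> carrier L"
    using assms by (auto simp: quad_in_K_iff)
  show "quad_meet a d b c a' d' b' c' \<sqsubseteq>\<^bsub>K\<^esub> x"
    if "x \<in> {quad L a d b c, quad L a' d' b' c'}" for x
    using that d by (auto simp: quad_meet_def quad_le_iff meet_left meet_right)
  show "quad_meet a d b c a' d' b' c' \<in> carrier K"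
    using assms by (auto simp: quad_meet_def quad_in_K_iff meet_eq_top_iff)
  show "y \<sqsubseteq>\<^bsub>K\<^esub> quad_meet a d b c a' d' b' c'"
    if "y \<in> Lower K {quad L a d b c, quad L a' d' b' c'}" for y
  proof -
    have le: "y \<sqsubseteq>\<^bsub>K\<^esub> quad L a d b c" "y \<sqsubseteq>\<^bsub>K\<^esub> quad L a' d' b' c'" and "y \<in> carrier K"
      using that assms by (auto simp: Lower_def)
    obtain p q r s where y: "y = quad L p q r s" and "quad L p q r s \<in> carrier K"
      using \<open>y \<in> carrier K\<close> by (rule K_cases)
    then have q: "q \<in> carrier L" by (simp add: quad_in_K_iff)
    show ?thesis
      using le d q by (auto simp: quad_meet_def quad_le_iff y intro: meet_le)
  qed
qed (use assms in auto)

text \<open>An upper bound in \<open>K(D)\<close> lies above the componentwise join and satisfies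
  the closure conditions itself, so every coordinate raised by \<open>quad_join\<close> is \<top>
  there too.\<close>

lemma is_lub_quad_join:
  assumes "quad L a d b c \<in> carrier K" "quad L a' d' b' c' \<in> carrier K"
  shows "is_lub K (quad_join a d b c a' d' b' c') {quad L a d b c, quad L a' d' b' c'}"
proof (rule least_UpperI)
  have d: "d \<in> carrier L" "d' \<in> carrier L"
    using assms by (auto simp: quad_in_K_iff)
  show "x \<sqsubseteq>\<^bsub>K\<^esub> quad_join a d b c a' d' b' c'"
    if "x \<in> {quad L a d b c, quad L a' d' b' c'}" for x
    using that d by (auto simp: quad_join_def quad_le_iff join_left join_right)
  show "quad_join a d b c a' d' b' c' \<in> carrier K"
    using d by (auto simp: quad_join_def quad_in_K_iff)
  show "quad_join a d b c a' d' b' c' \<sqsubseteq>\<^bsub>K\<^esub> y"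
    if "y \<in> Upper K {quad L a d b c, quad L a' d' b' c'}" for y
  proof -
    have le: "quad L a d b c \<sqsubseteq>\<^bsub>K\<^esub> y" "quad L a' d' b' c' \<sqsubseteq>\<^bsub>K\<^esub> y" and "y \<in> carrier K"
      using that assms by (auto simp: Upper_def)
    obtain p q r s where y: "y = quad L p q r s" and yK: "quad L p q r s \<in> carrier K"
      using \<open>y \<in> carrier K\<close> by (rule K_cases)
    then have q: "q \<in> carrier L" by (simp add: quad_in_K_iff)
    have *: "a \<or> a' \<longrightarrow> p" "b \<or> b' \<longrightarrow> r" "c \<or> c' \<longrightarrow> s" "d \<squnion> d' \<sqsubseteq> q"
      using le d q by (auto simp: quad_le_iff y intro: join_le)
    moreover have "d \<squnion> d' = \<top> \<longrightarrow> q = \<top>"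
      using * q by (auto simp: top_le_iff)
    ultimately show ?thesis
      using yK d q by (auto simp: quad_join_def quad_le_iff quad_in_K_iff y)
  qed
qed (use assms in auto)

lemma lattice_K: "lattice K"
proof -
  interpret K: partial_order K by (rule partial_order_K)
  show ?thesis
  proof
    fix x y assume "x \<in> carrier K" "y \<in> carrier K"
    then show "\<exists>z. is_lub K z {x, y}" "\<exists>z. is_glb K z {x, y}"
      by (metis K_cases is_lub_quad_join, metis K_cases is_glb_quad_meet)
  qed
qed

lemma K_meet:
  assumes "quad L a d b c \<in> carrier K" "quad L a' d' b' c' \<in> carrier K"
  shows "quad L a d b c \<sqinter>\<^bsub>K\<^esub> quad L a' d' b' c' = quad_meet a d b c a' d' b' c'"
  by (rule partial_order.is_glb_meet[OF partial_order_K is_glb_quad_meet[OF assms]])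

lemma K_join:
  assumes "quad L a d b c \<in> carrier K" "quad L a' d' b' c' \<in> carrier K"
  shows "quad L a d b c \<squnion>\<^bsub>K\<^esub> quad L a' d' b' c' = quad_join a d b c a' d' b' c'"
  by (rule partial_order.is_lub_join[OF partial_order_K is_lub_quad_join[OF assms]])

section \<open>The term functions of K(D)\<close>

text \<open>The second component answers in advance, for every polynomial, the test
  \<open>d \<squnion> d' = \<top>\<close> that \<open>quad_join\<close> makes on coordinate
  1.\<close>

definition pattern ::
    "nat \<Rightarrow> (nat \<Rightarrow> nat \<Rightarrow> 'a) \<Rightarrow> (nat \<times> nat) set \<times> ((nat \<Rightarrow> 'a) \<Rightarrow> 'a) set" where
  "pattern n v = ({(i, j). i < n \<and> j \<le> 3 \<and> v i j = \<top>},
    {s \<in> polynomials L n. s (\<lambda>i. v i 1) = \<top>})"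

definition patterns :: "nat \<Rightarrow> ((nat \<times> nat) set \<times> ((nat \<Rightarrow> 'a) \<Rightarrow> 'a) set) set" where
  "patterns n = Pow ({..<n} \<times> {..3}) \<times> Pow (polynomials L n)"

lemma finite_patterns: "finite (patterns n)"
  by (simp add: patterns_def finite_polynomials)

lemma pattern_in_patterns: "pattern n v \<in> patterns n"
  by (auto simp: pattern_def patterns_def)

text \<open>The quadruple is symbolic: coordinate 1 is kept as a polynomial, evaluated at the
  \<open>D\<close>-coordinates of \<open>v\<close>.\<close>

definition quad_value ::
    "(nat \<Rightarrow> nat \<Rightarrow> 'a) \<Rightarrow> bool \<times> ((nat \<Rightarrow> 'a) \<Rightarrow> 'a) \<times> bool \<times> bool \<Rightarrow> nat \<Rightarrow> 'a" where
  "quad_value v = (\<lambda>(a, s, b, c). quad L a (s (\<lambda>i. v i 1)) b c)"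

text \<open>By induction, the symbolic quadruple of a term is a function of the pattern alone. Meets
  act coordinatewise; for joins, the pattern decides which coordinates are raised.\<close>

lemma eval_term_K_by_pattern:
  assumes "vars t \<subseteq> {..<n}"
  shows "\<exists>a s b c. (\<forall>p. s p \<in> polynomials L n) \<and> (\<forall>v. range v \<subseteq> carrier K \<longrightarrow>
    eval_term K v t = quad_value v (a (pattern n v), s (pattern n v), b (pattern n v), c (pattern n v)))"
  using assms
proof (induction t)
  case (Var i)
  let ?s = "\<lambda>d\<in>points. d i"
  have "v i = quad_value v ((i, 0) \<in> fst (pattern n v), ?s, (i, 2) \<in> fst (pattern n v),
      (i, 3) \<in> fst (pattern n v))" if v: "range v \<subseteq> carrier K" for v
  proof -
    have "v i \<in> carrier K" using v by auto
    then obtain a d b c where vi: "v i = quad L a d b c"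
      by (rule K_cases)
    have "range (\<lambda>i. v i 1) \<subseteq> carrier L"
      using v by (rule range_coordinate_closed)
    then show ?thesis
      using Var vi nontrivial by (auto simp: quad_value_def pattern_def)
  qed
  moreover have "?s \<in> polynomials L n"
    using Var by (intro projection_in_polynomials) auto
  ultimately show ?case
    unfolding eval_term.simps
    by - (rule exI[of _ "\<lambda>p. (i, 0) \<in> fst p"], rule exI[of _ "\<lambda>p. ?s"],
        rule exI[of _ "\<lambda>p. (i, 2) \<in> fst p"], rule exI[of _ "\<lambda>p. (i, 3) \<in> fst p"], blast)
next
  case (Meet t t')
  obtain a s b c where s: "\<And>p. s p \<in> polynomials L n"
    and t: "\<And>v. range v \<subseteq> carrier K \<Longrightarrow> eval_term K v t =
      quad_value v (a (pattern n v), s (pattern n v), b (pattern n v), c (pattern n v))"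
    using Meet by auto
  obtain a' s' b' c' where s': "\<And>p. s' p \<in> polynomials L n"
    and t': "\<And>v. range v \<subseteq> carrier K \<Longrightarrow> eval_term K v t' =
      quad_value v (a' (pattern n v), s' (pattern n v), b' (pattern n v), c' (pattern n v))"
    using Meet by auto
  define u where "u p = (\<lambda>d\<in>points. s p d \<sqinter> s' p d)" for p
  have "eval_term K v (Meet t t') = quad_value v (a (pattern n v) \<and> a' (pattern n v),
      u (pattern n v), b (pattern n v) \<and> b' (pattern n v), c (pattern n v) \<and> c' (pattern n v))"
    if v: "range v \<subseteq> carrier K" for v
  proof -
    have "range (\<lambda>i. v i 1) \<subseteq> carrier L"
      using v by (rule range_coordinate_closed)
    moreover have "eval_term K v t \<in> carrier K" "eval_term K v t' \<in> carrier K"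
      using lattice.eval_term_closed[OF lattice_K v] by auto
    ultimately show ?thesis
      unfolding eval_term.simps t[OF v] t'[OF v] quad_value_def prod.case u_def
      by (simp add: K_meet quad_meet_def)
  qed
  moreover have "u p \<in> polynomials L n" for p
    unfolding u_def by (intro meet_in_polynomials s s')
  ultimately show ?case
    by - (rule exI[of _ "\<lambda>p. a p \<and> a' p"], rule exI[of _ u],
        rule exI[of _ "\<lambda>p. b p \<and> b' p"], rule exI[of _ "\<lambda>p. c p \<and> c' p"], blast)
next
  case (Join t t')
  obtain a s b c where s: "\<And>p. s p \<in> polynomials L n"
    and t: "\<And>v. range v \<subseteq> carrier K \<Longrightarrow> eval_term K v t =
      quad_value v (a (pattern n v), s (pattern n v), b (pattern n v), c (pattern n v))"
    using Join by auto
  obtain a' s' b' c' where s': "\<And>p. s' p \<in> polynomials L n"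
    and t': "\<And>v. range v \<subseteq> carrier K \<Longrightarrow> eval_term K v t' =
      quad_value v (a' (pattern n v), s' (pattern n v), b' (pattern n v), c' (pattern n v))"
    using Join by auto
  define u where "u p = (\<lambda>d\<in>points. s p d \<squnion> s' p d)" for p
  define A where "A p \<longleftrightarrow> a p \<or> a' p" for p
  define C where "C p \<longleftrightarrow> c p \<or> c' p" for p
  \<comment> \<open>Raising coordinate 1 replaces the polynomial by the constant \<top>. In
    \<open>B\<close>, membership of \<open>u p\<close> in \<open>snd p\<close> stands for
    \<open>u p\<close> evaluating to \<top>, so that the valuation itself does not occur.\<close>
  define S where "S p = (if A p \<and> (b p \<or> b' p \<or> C p) then \<lambda>d\<in>points. \<top> else u p)" for p
  define B where "B p \<longleftrightarrow> b p \<or> b' p \<or> C p \<and> (A p \<or> u p \<in> snd p)" for p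
  have u: "u p \<in> polynomials L n" for p
    unfolding u_def by (intro join_in_polynomials s s')
  have "eval_term K v (Join t t') =
      quad_value v (A (pattern n v), S (pattern n v), B (pattern n v), C (pattern n v))"
    if v: "range v \<subseteq> carrier K" for v
  proof -
    let ?p = "pattern n v" and ?d = "\<lambda>i. v i 1"
    have d: "range ?d \<subseteq> carrier L"
      using v by (rule range_coordinate_closed)
    then have ud: "u ?p ?d = s ?p ?d \<squnion> s' ?p ?d"
      by (simp add: u_def)
    have "S ?p ?d = (if A ?p \<and> (b ?p \<or> b' ?p \<or> C ?p) then \<top> else u ?p ?d)"
      using d by (auto simp: S_def)
    moreover have "u ?p \<in> snd ?p \<longleftrightarrow> u ?p ?d = \<top>"
      using u[of ?p] by (simp add: pattern_def)
    moreover have "eval_term K v t \<in> carrier K" "eval_term K v t' \<in> carrier K"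
      using lattice.eval_term_closed[OF lattice_K v] by auto
    ultimately show ?thesis
      unfolding eval_term.simps t[OF v] t'[OF v] quad_value_def prod.case A_def C_def B_def ud
      by (auto simp: K_join quad_join_def disj_assoc)
  qed
  moreover have "S p \<in> polynomials L n" for p
    unfolding S_def using u const_in_polynomials(2) by simp
  ultimately show ?case by blast
qed

text \<open>A term function is determined by a map from the finite set of patterns to the finite set
  of symbolic quadruples.\<close>

lemma finite_term_functions_K: "finite (term_function K ` {t. vars t \<subseteq> {..<n}})"
proof -
  define \<Phi> where "\<Phi> g = (\<lambda>v\<in>{v. range v \<subseteq> carrier K}. quad_value v (g (pattern n v)))" for g
  let ?G = "patterns n \<rightarrow>\<^sub>E (UNIV \<times> polynomials L n \<times> UNIV \<times> UNIV)"
  have "term_function K t \<in> \<Phi> ` ?G" if t: "vars t \<subseteq> {..<n}" for t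
  proof -
    obtain a s b c where s: "\<And>p. s p \<in> polynomials L n"
      and eval: "\<And>v. range v \<subseteq> carrier K \<Longrightarrow> eval_term K v t =
        quad_value v (a (pattern n v), s (pattern n v), b (pattern n v), c (pattern n v))"
      using eval_term_K_by_pattern[OF t] by blast
    \<comment> \<open>Restricting to \<open>patterns n\<close> puts the map into a finite function
      space and loses nothing, since every pattern of a valuation lies there.\<close>
    let ?g = "\<lambda>p\<in>patterns n. (a p, s p, b p, c p)"
    have "term_function K t = \<Phi> ?g"
      unfolding term_function_def \<Phi>_def
      by (rule restrict_ext) (simp add: eval pattern_in_patterns)
    moreover have "?g \<in> ?G" using s by auto
    ultimately show ?thesis by blast
  qed
  then have "term_function K ` {t. vars t \<subseteq> {..<n}} \<subseteq> \<Phi> ` ?G" by blast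
  moreover have "finite (\<Phi> ` ?G)"
    by (intro finite_imageI finite_PiE finite_patterns finite_cartesian_product finite_polynomials)
      simp_all
  ultimately show ?thesis by (rule finite_subset)
qed

end

theorem lemma8p5:
  fixes D :: "'a gorder"
  assumes "nontrivial_bounded_distributive_lattice D"
  shows "locally_finite_lattice (K_lattice D) \<and>
    (\<forall>L \<in> (generated_variety (K_lattice D) :: 'b gorder set). locally_finite_lattice L)"
proof (intro conjI ballI)
  interpret nontrivial_bounded_distributive_lattice D by (rule assms)
  \<comment> \<open>Here \<open>K(D)\<close> is compared with itself, so the transfer of identities
    is trivial.\<close>
  show "locally_finite_lattice (K_lattice D)"
    by (rule lattice.locally_finite_if_finite_term_functions[OF lattice_K finite_term_functions_K])
  fix L :: "'b gorder"
  assume L: "L \<in> generated_variety (K_lattice D)"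
  \<comment> \<open>The variety defined by all identities of \<open>K(D)\<close> contains
    \<open>K(D)\<close>, hence also every member of the generated variety.\<close>
  have "K_lattice D \<in> lattice_variety {e. satisfies_identity (K_lattice D) e}"
    using lattice_K by (simp add: lattice_variety_def)
  with L have "L \<in> lattice_variety {e. satisfies_identity (K_lattice D) e}"
    unfolding generated_variety_def by blast
  then have "lattice L" and "\<And>e. satisfies_identity (K_lattice D) e \<Longrightarrow> satisfies_identity L e"
    by (auto simp: lattice_variety_def)
  then show "locally_finite_lattice L"
    using lattice.locally_finite_if_finite_term_functions finite_term_functions_K by blast
qed

end
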